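(* Let $L,q\ge1$ be integers, $p=2^Lq$, and let $\mathcal{A}\in\mathbb{R}^{m\times n\times p}$. Then the Moore-Penrose inverse under the $w$-product satisfies: (1) $(\mathcal{A}^\dagger)^\dagger=\mathcal{A}$; (2) $(\mathcal{A}^\top)^\dagger=(\mathcal{A}^\dagger)^\top$; (3) $(\mathcal{A}\star_w\mathcal{A}^\top)^\dagger=(\mathcal{A}^\top)^\dagger\star_w\mathcal{A}^\dagger$; (4) $\mathcal{A}^\dagger=\mathcal{A}^\top\star_w(\mathcal{A}\star_w\mathcal{A}^\top)^\dagger$.
   Context: For a real third-order tensor $\mathcal{A}\in\mathbb{R}^{n_1\times n_2\times p}$ with $p=2^Lq$, $L,q\ge1$ integers, $\mathcal{A}[:,:,k]$ denotes its $k$-th frontal slice. Wavelet transform (lazy wavelet, along the third dimension): put $\mathcal{A}_{s_0}=\mathcal{A}$ and, for $j=1,\dots,L$ and $k=1,\dots,p/2^j$, $$\mathcal{A}_{d_j}[:,:,k]=\mathcal{A}_{s_{j-1}}[:,:,2k-1]-\mathcal{A}_{s_{j-1}}[:,:,2k],\qquad \mathcal{A}_{s_j}[:,:,k]=\mathcal{A}_{s_{j-1}}[:,:,2k]+\tfrac12\mathcal{A}_{d_j}[:,:,k].$$ Then $W_{[L]}(\mathcal{A})=(\mathcal{A}_{s_L},\mathcal{A}_{d_L},\dots,\mathcal{A}_{d_1})$; here $\mathcal{A}_{s_L}$ has $q$ frontal slices and $\mathcal{A}_{d_j}$ has $p/2^j$. The map $W_{[L]}$ is invertible, with inverse $W_{[L]}^{-1}$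 computed for $j=L,\dots,1$ by $\mathcal{A}_{s_{j-1}}[:,:,2k]=\mathcal{A}_{s_j}[:,:,k]-\tfrac12\mathcal{A}_{d_j}[:,:,k]$ and $\mathcal{A}_{s_{j-1}}[:,:,2k-1]=\mathcal{A}_{d_j}[:,:,k]+\mathcal{A}_{s_{j-1}}[:,:,2k]$. The $w$-product of $\mathcal{A}\in\mathbb{R}^{n_1\times n_2\times p}$ and $\mathcal{B}\in\mathbb{R}^{n_2\times n_3\times p}$ is $\mathcal{A}\star_w\mathcal{B}=W_{[L]}^{-1}(W_{[L]}(\mathcal{A})\,\Delta\,W_{[L]}(\mathcal{B}))\in\mathbb{R}^{n_1\times n_3\times p}$, where the face-product $\Delta$ multiplies corresponding frontal slices of corresponding components as matrices. The transpose is $\mathcal{A}^\top[i,j,:]=\mathcal{A}[j,i,:]$. Triple products are unambiguous since $\star_w$ is associative. The Moore-Penrose inverse $\mathcal{A}^\dagger$ of $\mathcal{A}\in\mathbb{R}^{m\times n\times p}$ is the (existing and unique) tensor $\mathcal{X}\in\mathbb{R}^{n\times m\times p}$ with $\mathcal{A}\star_w\mathcal{X}\star_w\mathcal{A}=\mathcal{A}$, $\mathcal{X}\star_w\mathcal{A}\star_w\mathcal{X}=\mathcal{X}$, $(\mathcal{A}\star_w\mathcal{X})^\top=\mathcal{A}\star_w\mathcal{X}$, $(\mathcal{X}\star_w\mathcal{A})^\top=\mathcal{X}\star_w\mathcal{A}$. *)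

theory Defs
  imports "HOL-Analysis.Analysis"
begin

text \<open>
  A tensor in \<open>\<real>\<^sup>m\<^sup>\<times>\<^sup>n\<^sup>\<times>\<^sup>p\<close> is the list, of length \<open>p\<close>, of its frontal slices.  Lists are indexed
  from 0, so the slices usually numbered \<open>2k-1\<close> and \<open>2k\<close> (with \<open>k \<ge> 1\<close>) are the entries
  \<open>2k\<close> and \<open>2k+1\<close> (with \<open>k \<ge> 0\<close>).
\<close>

type_synonym ('m, 'n) tensor = "(real ^ 'n ^ 'm) list"

text \<open>
  The components \<open>(A\<^sub>s\<^sub>L, [A\<^sub>d\<^sub>L, \<dots>, A\<^sub>d\<^sub>1])\<close> of a wavelet transform.
\<close>

type_synonym ('m, 'n) wcomponents = "('m, 'n) tensor \<times> ('m, 'n) tensor list"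

definition diff_step :: "('m::finite, 'n::finite) tensor \<Rightarrow> ('m, 'n) tensor" where
  "diff_step S = map (\<lambda>k. S ! (2 * k) - S ! (2 * k + 1)) [0..<length S div 2]"

definition smooth_step :: "('m::finite, 'n::finite) tensor \<Rightarrow> ('m, 'n) tensor" where
  "smooth_step S =
     map (\<lambda>k. S ! (2 * k + 1) + (1 / 2) *\<^sub>R (diff_step S ! k)) [0..<length S div 2]"

fun wav_s :: "nat \<Rightarrow> ('m::finite, 'n::finite) tensor \<Rightarrow> ('m, 'n) tensor" where
  "wav_s 0 A = A"
| "wav_s (Suc j) A = smooth_step (wav_s j A)"

text \<open>Only the values for \<open>j \<ge> 1\<close> are used.\<close>

definition wav_d :: "nat \<Rightarrow> ('m::finite, 'n::finite) tensor \<Rightarrow> ('m, 'n) tensor" where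
  "wav_d j A = diff_step (wav_s (j - 1) A)"

definition wavelet :: "nat \<Rightarrow> ('m::finite, 'n::finite) tensor \<Rightarrow> ('m, 'n) wcomponents" where
  "wavelet L A = (wav_s L A, map (\<lambda>j. wav_d j A) (rev [1..<Suc L]))"

text \<open>One step of the inverse transform: recovers \<open>A\<^sub>s\<^sub>j\<^sub>-\<^sub>1\<close> from \<open>A\<^sub>s\<^sub>j\<close> and \<open>A\<^sub>d\<^sub>j\<close>.\<close>

definition inv_step ::
  "('m::finite, 'n::finite) tensor \<Rightarrow> ('m, 'n) tensor \<Rightarrow> ('m, 'n) tensor" where
  "inv_step S D =
     concat (map2 (\<lambda>s d. let e = s - (1 / 2) *\<^sub>R d in [d + e, e]) S D)"

definition inv_wavelet :: "('m::finite, 'n::finite) wcomponents \<Rightarrow> ('m, 'n) tensor" where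
  "inv_wavelet C = foldl inv_step (fst C) (snd C)"

definition face_prod ::
  "('m::finite, 'n::finite) wcomponents \<Rightarrow> ('n, 'l::finite) wcomponents \<Rightarrow> ('m, 'l) wcomponents"
where
  "face_prod C D = (map2 (**) (fst C) (fst D), map2 (map2 (**)) (snd C) (snd D))"

definition wprod ::
  "nat \<Rightarrow> ('m::finite, 'n::finite) tensor \<Rightarrow> ('n, 'l::finite) tensor \<Rightarrow> ('m, 'l) tensor" where
  "wprod L A B = inv_wavelet (face_prod (wavelet L A) (wavelet L B))"

definition ttranspose :: "('m::finite, 'n::finite) tensor \<Rightarrow> ('n, 'm) tensor" where
  "ttranspose A = map transpose A"

definition is_mp_inverse ::
  "nat \<Rightarrow> ('m::finite, 'n::finite) tensor \<Rightarrow> ('n, 'm) tensor \<Rightarrow> bool" where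
  "is_mp_inverse L A X \<longleftrightarrow>
     length X = length A \<and>
     wprod L (wprod L A X) A = A \<and>
     wprod L (wprod L X A) X = X \<and>
     ttranspose (wprod L A X) = wprod L A X \<and>
     ttranspose (wprod L X A) = wprod L X A"

text \<open>
  Such a tensor exists and is unique whenever \<open>2 ^ L\<close> divides the length of \<open>A\<close>.
\<close>

definition mp_inverse :: "nat \<Rightarrow> ('m::finite, 'n::finite) tensor \<Rightarrow> ('n, 'm) tensor" where
  "mp_inverse L A = (THE X. is_mp_inverse L A X)"

end

theory Submission
  imports Defs
begin

text \<open>
  Listing all slices of all wavelet components turns the transform into a bijection \<open>flat L\<close> on
  tensors with \<open>p\<close> slices which carries the \<open>w\<close>-product to the slicewise matrix product and
  commutes with transposition.  Hence the Moore-Penrose inverse of a tensor is computed slicewise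
  in the transform domain, and the four identities reduce to those for real matrices.
\<close>

section \<open>The Moore-Penrose inverse of a real matrix\<close>

definition matrix_mp :: "real ^ 'n ^ 'm \<Rightarrow> real ^ 'm ^ 'n \<Rightarrow> bool" where
  "matrix_mp A X \<longleftrightarrow> A ** X ** A = A \<and> X ** A ** X = X \<and>
     transpose (A ** X) = A ** X \<and> transpose (X ** A) = X ** A"

text \<open>\<open>A ** X\<close> and \<open>A ** Y\<close> are both the orthogonal projection onto
  the column space of \<open>A\<close>, and \<open>X ** A\<close> and \<open>Y ** A\<close> that
  onto its row space, so \<open>X = X A X = Y A X = Y A Y = Y\<close>.\<close>

lemma matrix_mp_unique:
  fixes A :: "real ^ 'n ^ 'm"
  assumes "matrix_mp A X" "matrix_mp A Y"
  shows "X = Y"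
proof -
  have X: "A ** X ** A = A" "X ** A ** X = X" "transpose (A ** X) = A ** X"
      "transpose (X ** A) = X ** A"
    and Y: "A ** Y ** A = A" "Y ** A ** Y = Y" "transpose (A ** Y) = A ** Y"
      "transpose (Y ** A) = Y ** A"
    using assms by (simp_all add: matrix_mp_def)
  have "A ** X = transpose (A ** Y ** (A ** X))"
    by (simp add: matrix_mul_assoc X Y)
  also have "\<dots> = A ** X ** (A ** Y)"
    by (simp only: matrix_transpose_mul[of "A ** Y" "A ** X"] X Y)
  also have "\<dots> = A ** Y"
    by (simp add: matrix_mul_assoc X)
  finally have AX: "A ** X = A ** Y" .
  have "X ** A = transpose (X ** A ** (Y ** A))"
  proof -
    have "X ** A ** (Y ** A) = X ** (A ** Y ** A)"
      by (simp add: matrix_mul_assoc)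
    then show ?thesis by (simp only: X Y)
  qed
  also have "\<dots> = Y ** A ** (X ** A)"
    by (simp only: matrix_transpose_mul[of "X ** A" "Y ** A"] X Y)
  also have "\<dots> = Y ** (A ** X ** A)"
    by (simp add: matrix_mul_assoc)
  finally have XA: "X ** A = Y ** A"
    by (simp only: X)
  have "X = Y ** (A ** X)"
    using X(2) by (simp add: XA matrix_mul_assoc)
  also have "\<dots> = Y"
    by (simp add: AX matrix_mul_assoc Y)
  finally show ?thesis .
qed

section \<open>Existence of the inverse via Gram matrices\<close>

lemma matrix_diff_ldistrib:
  fixes A :: "real ^ 'n ^ 'm"
  shows "A ** (B - C) = A ** B - A ** C"
  by (simp add: matrix_matrix_mult_def vec_eq_iff right_diff_distrib sum_subtractf)

text \<open>The matrix of a linear right inverse of \<open>A\<close> on its range serves as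
  \<open>G\<close>; no symmetry is claimed.\<close>

lemma generalized_inverse_exists:
  fixes A :: "real ^ 'n ^ 'm"
  obtains G where "A ** G ** A = A"
proof -
  obtain g where g: "linear g" "\<And>v. A *v g (A *v v) = A *v v"
    using linear_exists_right_inverse_on[OF matrix_vector_mul_linear[of A] subspace_UNIV]
    by auto
  have "A ** matrix g ** A = A"
    using g by (simp add: matrix_eq flip: matrix_vector_mul_assoc matrix_vector_mul(1))
  then show ?thesis by (rule that)
qed

text \<open>The squared norm of \<open>M *v x\<close> is the inner product of \<open>x\<close> with
  \<open>(transpose M ** M) *v x\<close>.\<close>

lemma gram_eq_zero_imp_eq_zero:
  fixes M :: "real ^ 'n ^ 'm"
  assumes "transpose M ** M = 0"
  shows "M = 0"
proof -
  have "M *v x = 0" for x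
  proof -
    have "(M *v x) \<bullet> (M *v x) = x \<bullet> ((transpose M ** M) *v x)"
      by (metis dot_lmul_matrix matrix_vector_mul_assoc transpose_matrix_vector transpose_transpose)
    then show ?thesis using assms by simp
  qed
  then show ?thesis by (simp add: matrix_eq)
qed

text \<open>\<open>A G A\<^sup>T\<close> is the orthogonal projection onto the column space of \<open>A\<close>.\<close>

lemma gram_generalized_inverse:
  fixes A :: "real ^ 'n ^ 'm"
  assumes G: "(transpose A ** A) ** G ** (transpose A ** A) = transpose A ** A"
  shows "A ** G ** transpose A ** A = A"
    and "transpose (A ** G ** transpose A) = A ** G ** transpose A"
proof -
  \<comment> \<open>Kept general in \<open>H\<close>, since it is applied to both \<open>G\<close>
    and \<open>transpose G\<close>.\<close>
  have absorb: "A ** H ** transpose A ** A = A"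
    if H: "(transpose A ** A) ** H ** (transpose A ** A) = transpose A ** A" for H
  proof -
    \<comment> \<open>The claim amounts to \<open>A ** K = 0\<close>. The hypothesis gives this
      multiplied by \<open>transpose A\<close>, a factor that the Gram lemma cancels.\<close>
    define K where "K = H ** transpose A ** A - mat 1"
    have "transpose A ** (A ** K) = 0"
      using H unfolding K_def
      by (simp add: matrix_mul_assoc matrix_diff_ldistrib del: transpose_matrix_vector)
    then have "transpose (A ** K) ** (A ** K) = 0"
      by (simp add: matrix_transpose_mul times0_right flip: matrix_mul_assoc)
    then have "A ** K = 0" by (rule gram_eq_zero_imp_eq_zero)
    then show ?thesis
      unfolding K_def by (simp add: matrix_mul_assoc matrix_diff_ldistrib)
  qed
  show a: "A ** G ** transpose A ** A = A" using G by (rule absorb)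
  let ?P = "A ** G ** transpose A"
  \<comment> \<open>The Gram matrix is symmetric, so \<open>transpose G\<close> is a generalized
    inverse of it too.\<close>
  have "transpose (transpose A ** A ** G ** (transpose A ** A)) = transpose (transpose A ** A)"
    by (simp only: G)
  then have "A ** transpose G ** transpose A ** A = A"
    by (intro absorb) (simp add: matrix_transpose_mul matrix_mul_assoc)
  then have "transpose ?P ** A = A"
    by (simp add: matrix_transpose_mul matrix_mul_assoc)
  \<comment> \<open>The left side is symmetric, hence so is \<open>?P\<close>.\<close>
  then have "transpose ?P ** ?P = ?P"
    by (simp add: matrix_mul_assoc)
  moreover have "transpose (transpose ?P ** ?P) = transpose ?P ** ?P"
    by (simp only: matrix_transpose_mul transpose_transpose matrix_mul_assoc)
  ultimately show "transpose ?P = ?P" by simp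
qed

text \<open>\<open>G ** transpose A\<close> already yields the projection \<open>?P\<close> when
  multiplied by \<open>A\<close> from the left; the extra factor \<open>?Q\<close>, the projection
  onto the row space, makes \<open>?X ** A\<close> symmetric as well.\<close>

lemma matrix_mp_exists:
  fixes A :: "real ^ 'n ^ 'm"
  shows "\<exists>X. matrix_mp A X"
proof -
  obtain G where G: "transpose A ** A ** G ** (transpose A ** A) = transpose A ** A"
    by (rule generalized_inverse_exists)
  obtain H where H: "A ** transpose A ** H ** (A ** transpose A) = A ** transpose A"
    by (rule generalized_inverse_exists)
  let ?P = "A ** G ** transpose A" and ?Q = "transpose A ** H ** A"
  let ?X = "?Q ** G ** transpose A"
  note P = gram_generalized_inverse[OF G]
  have Q: "?Q ** transpose A = transpose A" "transpose ?Q = ?Q"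
    using gram_generalized_inverse[of "transpose A" H] H by simp_all
  have AQ: "A ** ?Q = A"
    using arg_cong[OF Q(1), of transpose]
    by (simp only: matrix_transpose_mul[of ?Q] Q(2) transpose_transpose)
  have QQ: "?Q ** ?Q = ?Q"
    using Q(1) by (simp add: matrix_mul_assoc)
  have AX: "A ** ?X = ?P"
    using AQ by (simp add: matrix_mul_assoc)
  have "?X ** A = transpose A ** H ** (?P ** A)"
    by (simp add: matrix_mul_assoc)
  also have "\<dots> = ?Q"
    by (simp only: P)
  finally have XA: "?X ** A = ?Q" .
  have "matrix_mp A ?X"
    unfolding matrix_mp_def AX XA
    using P Q(2) QQ by (simp add: matrix_mul_assoc)
  then show ?thesis ..
qed

section \<open>Identities for the matrix inverse\<close>

definition matrix_pinv :: "real ^ 'n ^ 'm \<Rightarrow> real ^ 'm ^ 'n" where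
  "matrix_pinv A = (SOME X. matrix_mp A X)"

lemma matrix_mp_iff: "matrix_mp A X \<longleftrightarrow> X = matrix_pinv A"
  using matrix_mp_exists matrix_mp_unique unfolding matrix_pinv_def by (metis someI_ex)

lemma matrix_mp_pinv: "matrix_mp A (matrix_pinv A)"
  by (simp add: matrix_mp_iff)

text \<open>The four equations are symmetric in the matrix and its inverse.\<close>

lemma matrix_pinv_pinv: "matrix_pinv (matrix_pinv A) = A"
proof -
  have "matrix_mp (matrix_pinv A) A"
    using matrix_mp_pinv[of A] by (simp add: matrix_mp_def)
  then show ?thesis by (simp add: matrix_mp_iff)
qed

text \<open>Transposition reverses products, so it preserves the first two equations and exchanges
  the two symmetry conditions.\<close>

lemma matrix_pinv_transpose: "matrix_pinv (transpose A) = transpose (matrix_pinv A)"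
proof -
  define X where "X = matrix_pinv A"
  have X: "A ** X ** A = A" "X ** A ** X = X" "transpose (A ** X) = A ** X"
      "transpose (X ** A) = X ** A"
    using matrix_mp_pinv[of A] by (simp_all add: matrix_mp_def X_def)
  have "transpose A ** transpose X ** transpose A = transpose A"
    "transpose X ** transpose A ** transpose X = transpose X"
    using X(1,2)[THEN arg_cong, of transpose]
    by (simp_all only: matrix_transpose_mul matrix_mul_assoc)
  then have "matrix_mp (transpose A) (transpose X)"
    unfolding matrix_mp_def by (simp only: X flip: matrix_transpose_mul)
  then show ?thesis by (simp add: matrix_mp_iff X_def)
qed

text \<open>The products \<open>?B ** ?Y\<close> and \<open>?Y ** ?B\<close> both equal the
  symmetric projection \<open>A ** X\<close>, which fixes \<open>?B\<close> and
  \<open>?Y\<close>.\<close>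

lemma matrix_pinv_mult_transpose:
  "matrix_pinv (A ** transpose A) = matrix_pinv (transpose A) ** matrix_pinv A"
proof -
  define X where "X = matrix_pinv A"
  have X: "A ** X ** A = A" "X ** A ** X = X" "transpose (A ** X) = A ** X"
      "transpose (X ** A) = X ** A"
    using matrix_mp_pinv[of A] by (simp_all add: matrix_mp_def X_def)
  have X': "transpose A ** transpose X = X ** A" "transpose X ** transpose A = A ** X"
    using X(3,4) by (simp_all only: matrix_transpose_mul)
  have AXX: "A ** X ** transpose X = transpose X"
    using arg_cong[OF X(2), of transpose] X'(2)
    by (simp only: matrix_transpose_mul matrix_mul_assoc)
  let ?B = "A ** transpose A" and ?Y = "transpose X ** X"
  have "?B ** ?Y = A ** (transpose A ** transpose X) ** X"
    by (simp only: matrix_mul_assoc)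
  also have "\<dots> = A ** X"
    unfolding X' by (simp only: matrix_mul_assoc X)
  finally have BY: "?B ** ?Y = A ** X" .
  have "?Y ** ?B = transpose X ** (X ** A) ** transpose A"
    by (simp only: matrix_mul_assoc)
  also have "\<dots> = (transpose X ** transpose A) ** (transpose X ** transpose A)"
    by (simp only: matrix_mul_assoc flip: X'(1))
  also have "\<dots> = A ** X"
    unfolding X' by (simp only: matrix_mul_assoc X)
  finally have YB: "?Y ** ?B = A ** X" .
  have "A ** X ** ?B = ?B" "A ** X ** ?Y = ?Y"
    by (simp_all only: matrix_mul_assoc X AXX)
  then have "matrix_mp ?B ?Y"
    unfolding matrix_mp_def BY YB by (simp only: X)
  then show ?thesis
    by (simp add: matrix_mp_iff matrix_pinv_transpose X_def)
qed

text \<open>Writing \<open>X\<close> for the inverse of \<open>A\<close>, the right side is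
  \<open>transpose A ** transpose X ** X = X ** A ** X = X\<close>.\<close>

lemma matrix_pinv_eq_transpose_mult:
  "matrix_pinv A = transpose A ** matrix_pinv (A ** transpose A)"
proof -
  have "transpose A ** transpose (matrix_pinv A) ** matrix_pinv A = matrix_pinv A"
    using matrix_mp_pinv[of A] by (simp add: matrix_mp_def flip: matrix_transpose_mul)
  then show ?thesis
    by (simp add: matrix_pinv_mult_transpose matrix_pinv_transpose matrix_mul_assoc)
qed

section \<open>The transform domain\<close>

lemma length_diff_step [simp]: "length (diff_step S) = length S div 2"
  by (simp add: diff_step_def)

lemma length_smooth_step [simp]: "length (smooth_step S) = length S div 2"
  by (simp add: smooth_step_def)

lemma inv_step_Nil [simp]: "inv_step [] [] = []"
  by (simp add: inv_step_def)

lemma inv_step_Cons [simp]: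
  "inv_step (s # S) (d # D) =
     (d + (s - (1 / 2) *\<^sub>R d)) # (s - (1 / 2) *\<^sub>R d) # inv_step S D"
  by (simp add: inv_step_def Let_def)

text \<open>Recursion by two slices at a time replaces the index formula, so that later facts follow
  by list induction.\<close>

lemma diff_step_Cons_Cons [simp]: "diff_step (a # b # S) = (a - b) # diff_step S"
  by (rule nth_equalityI) (auto simp: diff_step_def less_Suc_eq_0_disj simp del: upt_Suc)

lemma smooth_step_Cons_Cons [simp]:
  "smooth_step (a # b # S) = (b + (1 / 2) *\<^sub>R (a - b)) # smooth_step S"
  by (rule nth_equalityI) (auto simp: smooth_step_def less_Suc_eq_0_disj simp del: upt_Suc)

lemma steps_short [simp]:
  "length S < 2 \<Longrightarrow> diff_step S = []" "length S < 2 \<Longrightarrow> smooth_step S = []"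
  by (simp_all add: diff_step_def smooth_step_def)

lemma length_inv_step [simp]: "length S = length D \<Longrightarrow> length (inv_step S D) = 2 * length D"
  by (induction S D rule: list_induct2) simp_all

lemma smooth_step_inv_step [simp]: "length S = length D \<Longrightarrow> smooth_step (inv_step S D) = S"
  by (induction S D rule: list_induct2) simp_all

lemma diff_step_inv_step [simp]: "length S = length D \<Longrightarrow> diff_step (inv_step S D) = D"
  by (induction S D rule: list_induct2) simp_all

text \<open>Evenness matters: on an odd length both steps discard the last slice.\<close>

lemma inv_step_steps [simp]:
  "even (length S) \<Longrightarrow> inv_step (smooth_step S) (diff_step S) = S"
  by (induction S rule: induct_list012) simp_all

lemma diff_step_ttranspose: "diff_step (ttranspose S) = ttranspose (diff_step S)"
  by (induction S rule: induct_list012) (simp_all add: ttranspose_def transpose_def vec_eq_iff)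

lemma smooth_step_ttranspose: "smooth_step (ttranspose S) = ttranspose (smooth_step S)"
  by (induction S rule: induct_list012) (simp_all add: ttranspose_def transpose_def vec_eq_iff)

text \<open>The components of \<open>wavelet L A\<close> in one list, coarsest first. Peeling off
  the finest level fits induction on \<open>L\<close> with \<open>A\<close> arbitrary.\<close>

fun flat :: "nat \<Rightarrow> ('m::finite, 'n::finite) tensor \<Rightarrow> ('m, 'n) tensor" where
  "flat 0 A = A"
| "flat (Suc L) A = flat L (smooth_step A) @ diff_step A"

lemma half_multiple:
  assumes "2 ^ Suc L dvd (n::nat)"
  shows "even n" "2 ^ L dvd n div 2" "n div 2 + n div 2 = n"
  using assms by (auto elim!: dvdE)

lemma length_flat: "2 ^ L dvd length A \<Longrightarrow> length (flat L A) = length A"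
proof (induction L arbitrary: A)
  case (Suc L)
  then show ?case using half_multiple[OF Suc.prems] by simp
qed simp

lemma flat_ttranspose: "flat L (ttranspose A) = ttranspose (flat L A)"
  by (induction L arbitrary: A)
    (simp_all add: diff_step_ttranspose smooth_step_ttranspose, simp add: ttranspose_def)

lemma flat_inject:
  assumes "2 ^ L dvd length A" "length A = length B" "flat L A = flat L B"
  shows "A = B"
  using assms
proof (induction L arbitrary: A B)
  case (Suc L)
  note half = half_multiple[OF Suc.prems(1)]
  \<comment> \<open>The detail parts have equal length, so the appended lists agree block by
    block.\<close>
  have "flat L (smooth_step A) = flat L (smooth_step B)" "diff_step A = diff_step B"
    using Suc.prems by simp_all
  moreover from this have "smooth_step A = smooth_step B"
    using Suc.IH half Suc.prems(2) by simp
  ultimately show ?case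
    using inv_step_steps half Suc.prems(2) by metis
qed simp

lemma flat_surj:
  assumes "2 ^ L dvd length C"
  obtains B where "length B = length C" "flat L B = C"
proof -
  have "\<exists>B. length B = length C \<and> flat L B = C"
    using assms
  proof (induction L arbitrary: C)
    case (Suc L)
    note half = half_multiple[OF Suc.prems]
    \<comment> \<open>The first half of \<open>C\<close> is pulled back to a smooth part by
      induction; the second half is the finest detail.\<close>
    let ?h = "length C div 2"
    have "length (take ?h C) = ?h" by simp
    then obtain S where S: "length S = ?h" "flat L S = take ?h C"
      using Suc.IH[of "take ?h C"] half by metis
    have "length (drop ?h C) = ?h" using half(3) by simp
    then have "length (inv_step S (drop ?h C)) = length C"
      "flat (Suc L) (inv_step S (drop ?h C)) = C"
      using S half by simp_all
    then show ?case by blast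
  qed simp
  then show ?thesis using that by blast
qed

section \<open>Recursion of the transform and the product on the finest level\<close>

lemma wav_s_Suc: "wav_s (Suc j) A = wav_s j (smooth_step A)"
  by (induction j) simp_all

lemma wavelet_Suc:
  "wavelet (Suc L) A =
     (fst (wavelet L (smooth_step A)), snd (wavelet L (smooth_step A)) @ [diff_step A])"
proof -
  have "rev [1..<Suc (Suc L)] = map Suc (rev [1..<Suc L]) @ [1]"
    by (simp add: map_Suc_upt upt_conv_Cons rev_map flip: rev_map del: upt_Suc)
  \<comment> \<open>At \<open>j = 0\<close> the truncated subtraction in \<open>wav_d\<close> would
    break the shift of levels.\<close>
  moreover have "wav_d (Suc j) A = wav_d j (smooth_step A)" if "j \<ge> 1" for j
    using that by (cases j) (simp_all add: wav_d_def wav_s_Suc del: wav_s.simps(2))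
  ultimately show ?thesis
    by (simp add: wavelet_def wav_s_Suc wav_d_def[of "Suc 0"] del: upt_Suc wav_s.simps(2))
qed

lemma wprod_0: "wprod 0 A B = map2 (**) A B"
  by (simp add: wprod_def wavelet_def face_prod_def inv_wavelet_def)

lemma wprod_Suc:
  "wprod (Suc L) A B = inv_step (wprod L (smooth_step A) (smooth_step B))
     (map2 (**) (diff_step A) (diff_step B))"
proof -
  \<comment> \<open>Equal lengths keep the finest details paired in \<open>face_prod\<close>;
    \<open>foldl\<close> then processes them last, as the outermost \<open>inv_step\<close>.\<close>
  have len: "length (snd (wavelet L C)) = L" for C :: "('x::finite, 'y::finite) tensor"
    by (simp add: wavelet_def)
  show ?thesis
    by (simp add: wprod_def wavelet_Suc face_prod_def inv_wavelet_def len)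
qed

lemma length_wprod:
  "2 ^ L dvd length A \<Longrightarrow> length A = length B \<Longrightarrow> length (wprod L A B) = length A"
proof (induction L arbitrary: A B)
  case (Suc L)
  then show ?case using half_multiple[OF Suc.prems(1)] by (simp add: wprod_Suc)
qed (simp add: wprod_0)

text \<open>At each level the forward steps undo the \<open>inv_step\<close> of the product, leaving
  only the face-product.\<close>

lemma flat_wprod:
  assumes "2 ^ L dvd length A" "length A = length B"
  shows "flat L (wprod L A B) = map2 (**) (flat L A) (flat L B)"
  using assms
proof (induction L arbitrary: A B)
  case (Suc L)
  note half = half_multiple[OF Suc.prems(1)]
  have "length (wprod L (smooth_step A) (smooth_step B)) = length A div 2"
    using half Suc.prems by (simp add: length_wprod)
  then show ?case
    using half Suc by (simp add: wprod_Suc length_flat)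
qed (simp add: wprod_0)

section \<open>The Moore-Penrose inverse of a tensor\<close>

text \<open>By injectivity of \<open>flat L\<close>, the tensor equations hold exactly when
  \<open>matrix_mp\<close> holds at every slice of the transform.\<close>

lemma is_mp_inverse_iff:
  fixes A :: "('m::finite, 'n::finite) tensor"
  assumes A: "2 ^ L dvd length A"
  shows "is_mp_inverse L A X \<longleftrightarrow>
    length X = length A \<and> flat L X = map matrix_pinv (flat L A)"
proof (cases "length X = length A")
  case True
  \<comment> \<open>Polymorphic in the slice dimensions, since the four equations concern tensors of
    different shapes.\<close>
  have tensor_eq: "B = C \<longleftrightarrow> (\<forall>i<length A. flat L B ! i = flat L C ! i)"
    if "length B = length A" "length C = length A"
    for B C :: "('x::finite, 'y::finite) tensor"
    using flat_inject[of L B C] that A by (auto simp: list_eq_iff_nth_eq[of "flat L B"] length_flat)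
  have wprod: "length (wprod L B C) = length A"
    "i < length A \<Longrightarrow> flat L (wprod L B C) ! i = flat L B ! i ** flat L C ! i"
    if "length B = length A" "length C = length A"
    for B :: "('x::finite, 'y::finite) tensor" and C :: "('y, 'z::finite) tensor" and i
    using that A by (simp_all add: length_wprod flat_wprod length_flat)
  have ttranspose: "length (ttranspose B) = length A"
    "i < length A \<Longrightarrow> flat L (ttranspose B) ! i = transpose (flat L B ! i)"
    if "length B = length A" for B :: "('x::finite, 'y::finite) tensor" and i
    using that A by (simp_all add: flat_ttranspose length_flat, simp_all add: ttranspose_def length_flat)
  have "is_mp_inverse L A X \<longleftrightarrow>
    (\<forall>i<length A. matrix_mp (flat L A ! i) (flat L X ! i))"
    unfolding is_mp_inverse_def matrix_mp_def
    by (auto simp: True tensor_eq wprod ttranspose)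
  then show ?thesis
    using True A by (auto simp: matrix_mp_iff list_eq_iff_nth_eq length_flat)
qed (auto simp: is_mp_inverse_def)

text \<open>Surjectivity of \<open>flat L\<close> gives existence and injectivity gives uniqueness,
  so the description in \<open>mp_inverse\<close> is proper.\<close>

lemma mp_inverse_flat:
  assumes A: "2 ^ L dvd length A"
  shows "length (mp_inverse L A) = length A"
    and "flat L (mp_inverse L A) = map matrix_pinv (flat L A)"
proof -
  have len: "length (map matrix_pinv (flat L A)) = length A"
    using A by (simp add: length_flat)
  then obtain X where X: "length X = length A" "flat L X = map matrix_pinv (flat L A)"
    using flat_surj[of L "map matrix_pinv (flat L A)"] A by auto
  have "mp_inverse L A = X"
    unfolding mp_inverse_def is_mp_inverse_iff[OF A]
  proof (rule the_equality)
    show "Y = X" if "length Y = length A \<and> flat L Y = map matrix_pinv (flat L A)" for Y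
      using that X A by (intro flat_inject[of L Y X]) simp_all
  qed (use X in simp)
  then show "length (mp_inverse L A) = length A"
    "flat L (mp_inverse L A) = map matrix_pinv (flat L A)"
    using X by simp_all
qed

theorem lemma2p4:
  fixes A :: "('m::finite, 'n::finite) tensor" and L q :: nat
  assumes "L \<ge> 1" and "q \<ge> 1" and "length A = 2 ^ L * q"
  shows "mp_inverse L (mp_inverse L A) = A \<and>
         mp_inverse L (ttranspose A) = ttranspose (mp_inverse L A) \<and>
         mp_inverse L (wprod L A (ttranspose A)) =
           wprod L (mp_inverse L (ttranspose A)) (mp_inverse L A) \<and>
         mp_inverse L A =
           wprod L (ttranspose A) (mp_inverse L (wprod L A (ttranspose A)))"
proof -
  have A: "2 ^ L dvd length A" using assms(3) by simp
  have T: "length (ttranspose B) = length B" for B :: "('x::finite, 'y::finite) tensor"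
    by (simp add: ttranspose_def)
  note simps = A T mp_inverse_flat length_wprod flat_wprod flat_ttranspose length_flat
  show ?thesis
  \<comment> \<open>Each identity is compared after applying \<open>flat L\<close>, where it is the
    matrix identity at every slice; the length conditions are left to the end.\<close>
  proof (intro conjI; rule flat_inject[of L])
    show "flat L (mp_inverse L (mp_inverse L A)) = flat L A"
      by (simp add: simps matrix_pinv_pinv comp_def)
    show "flat L (mp_inverse L (ttranspose A)) = flat L (ttranspose (mp_inverse L A))"
      by (simp add: simps) (simp add: ttranspose_def matrix_pinv_transpose)
    show "flat L (mp_inverse L (wprod L A (ttranspose A))) =
        flat L (wprod L (mp_inverse L (ttranspose A)) (mp_inverse L A))"
      by (simp add: simps)
        (simp add: list_eq_iff_nth_eq ttranspose_def matrix_pinv_mult_transpose)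
    show "flat L (mp_inverse L A) =
        flat L (wprod L (ttranspose A) (mp_inverse L (wprod L A (ttranspose A))))"
      by (simp add: simps)
        (simp add: list_eq_iff_nth_eq ttranspose_def flip: matrix_pinv_eq_transpose_mult)
  qed (simp_all add: simps)
qed

end
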